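(* Let $k$ be a positive integer and let $G$ be a connected graph of order $n$ that contains $k$ independent (pairwise non-adjacent, distinct) vertices. Write $\sigma_k=\sigma_k(G)$. (1) If $\sigma_k\leq 7k$ or $\sigma_k\geq 8k$, then $$rvc(G)\leq \frac{(4k+2k^{2})n}{\sigma_k+k}+5k.$$ (2) If $7k<\sigma_k< 8k$, then $$rvc(G)\leq \frac{\left(\frac{38k}{9}+2k^{2}\right)n}{\sigma_k+k}+5k.$$
   Context: All graphs are finite, undirected and simple; the order of a graph is its number of vertices. A vertex-coloring of $G$ is any map from $V(G)$ to a finite set of colors (adjacent vertices may receive the same color). Given a vertex-coloring, $G$ is rainbow vertex-connected if for every pair of distinct vertices $u,v$ of $G$ there is a $u$-$v$ path in $G$ whose internal vertices all have distinct colors. For a connected graph $G$, the rainbow vertex-connection number $rvc(G)$ is the minimum number of colors in a vertex-coloring of $G$ that makes $G$ rainbow vertex-connected. For a graph $G$ containing $k$ independent vertices, $\sigma_k(G)$ is the minimum of $d(u_1)+d(u_2)+\cdots+d(u_k)$ over all sets of $k$ distinct pairwise non-adjacent vertices $u_1,\dots,u_k$ of $G$, where $d(u)$ denotes the degree of $u$ in $G$. *)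

theory Defs
  imports Complex_Main "Graph_Theory.Graph_Theory"
begin

text \<open>
  A finite simple undirected graph is a \<^locale>\<open>pair_graph\<close>: a finite loop-free digraph whose
  arc relation is symmetric. By symmetry, the degree of a vertex is its \<^const>\<open>out_degree\<close>.
\<close>

definition independent_set :: "('a, 'b) pre_digraph \<Rightarrow> 'a set \<Rightarrow> bool" where
  "independent_set G S \<longleftrightarrow>
     S \<subseteq> verts G \<and> (\<forall>u\<in>S. \<forall>v\<in>S. u \<noteq> v \<longrightarrow> (u, v) \<notin> arcs_ends G)"

text \<open>Meaningful only for finite graphs that contain \<open>k\<close> independent vertices
  (otherwise \<^const>\<open>Min\<close> is applied to the empty set or an infinite one).\<close>

definition sigma :: "nat \<Rightarrow> ('a, 'b) pre_digraph \<Rightarrow> nat" where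
  "sigma k G = Min {(\<Sum>u\<in>S. out_degree G u) | S. independent_set G S \<and> card S = k}"

text \<open>For a path \<open>p\<close> given as its list of vertices, with distinct ends, the internal vertices
  are those of \<open>butlast (tl p)\<close>.\<close>

definition rainbow_vertex_connected :: "('a, 'b) pre_digraph \<Rightarrow> ('a \<Rightarrow> 'c) \<Rightarrow> bool" where
  "rainbow_vertex_connected G c \<longleftrightarrow>
     (\<forall>u\<in>verts G. \<forall>v\<in>verts G. u \<noteq> v \<longrightarrow>
        (\<exists>p. vpath p G \<and> hd p = u \<and> last p = v \<and> distinct (map c (butlast (tl p)))))"

text \<open>Colors are natural numbers, without loss of generality for a finite graph. Every vertex is
  colored, so a complete graph with at least one vertex has value 1 rather than the value 0
  sometimes assigned to it by convention. Meaningful only for connected finite graphs.\<close>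

definition rvc :: "('a, 'b) pre_digraph \<Rightarrow> nat" where
  "rvc G = (LEAST m. \<exists>c :: 'a \<Rightarrow> nat. card (c ` verts G) = m \<and> rainbow_vertex_connected G c)"

end

theory Submission
  imports Defs
begin

text \<open>
  Put \<open>D = (\<sigma>\<^sub>k + k) / k\<close>. The set \<open>L\<close> of vertices of degree below \<open>D - 1\<close> contains no \<open>k\<close>
  independent vertices, since their degree sum would be less than \<open>\<sigma>\<^sub>k\<close>. Grow a connected set
  \<open>S\<close>, adding at a time a path of at most three vertices that ends in a vertex \<open>u\<close> outside the
  closed neighbourhood \<open>N[S]\<close>, as long as \<open>u\<close> is in \<open>L\<close> (at most \<open>k - 1\<close> times) or the path has at
  most \<open>6/D\<close> vertices for each new vertex of \<open>N[S]\<close>. At the end \<open>|S| \<le> 3k - 2 + 6|N[S]|/D\<close>, every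
  vertex is within distance two of \<open>S\<close>, and those not in \<open>N[S]\<close> have at least \<open>2D/3\<close> neighbours in
  \<open>N[S]\<close>. Hence some partition of \<open>N[S]\<close> into two classes leaves at most \<open>3/(2D)\<close> of the vertices
  outside \<open>N[S]\<close> with neighbours in one class only; each of them is repaired by adding one vertex to
  \<open>S\<close>. Distinct colours on \<open>S\<close> and two further colours for the two classes then give
  \<open>rvc G \<le> 6n/D + 3k\<close>, which is stronger than both claimed bounds.
\<close>

section \<open>Connected vertex sets and rainbow paths inside them\<close>

definition connected_set :: "'a rel \<Rightarrow> 'a set \<Rightarrow> bool" where
  "connected_set E S \<longleftrightarrow> (\<forall>u\<in>S. \<forall>v\<in>S. (u, v) \<in> (E \<inter> S \<times> S)\<^sup>*)"

definition closed_nbhd :: "'a rel \<Rightarrow> 'a set \<Rightarrow> 'a set" where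
  "closed_nbhd E S = S \<union> E `` S"

lemma closed_nbhd_mono: "S \<subseteq> T \<Longrightarrow> closed_nbhd E S \<subseteq> closed_nbhd E T"
  by (auto simp: closed_nbhd_def)

lemma connected_set_insert:
  assumes "connected_set E S" "sym E" "s \<in> S" "(s, y) \<in> E"
  shows "connected_set E (insert y S)"
proof -
  let ?R = "E \<inter> insert y S \<times> insert y S"
  have sub: "(E \<inter> S \<times> S)\<^sup>* \<subseteq> ?R\<^sup>*"
    by (rule rtrancl_mono) auto
  have sy: "(s, y) \<in> ?R" "(y, s) \<in> ?R"
    using assms by (auto dest: symD)
  have *: "(u, s) \<in> ?R\<^sup>* \<and> (s, u) \<in> ?R\<^sup>*" if "u \<in> insert y S" for u
    using that sy sub assms(1,3) unfolding connected_set_def by blast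
  show ?thesis
    unfolding connected_set_def using * by (meson rtrancl_trans)
qed

lemma connected_set_Un:
  assumes "finite Y" "connected_set E S" "sym E" "Y \<subseteq> E `` S"
  shows "connected_set E (S \<union> Y)"
  using assms(1,4)
proof (induction rule: finite_induct)
  case (insert y Y)
  then obtain s where "s \<in> S" "(s, y) \<in> E" by blast
  then show ?case
    using connected_set_insert[of E "S \<union> Y" s y] insert assms(3) by auto
qed (use assms in auto)

lemma rtrancl_exits_set:
  assumes "(u, v) \<in> R\<^sup>*" "u \<in> A" "v \<notin> A"
  obtains x y where "(x, y) \<in> R" "x \<in> A" "y \<notin> A"
  using assms by (induction rule: rtrancl_induct) blast+

text \<open>Induction along the relation gives a walk in \<open>Z\<close>; shortening it to a path
  only drops vertices, so it stays in \<open>Z\<close>.\<close>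

lemma rtrancl_restrict_imp_vpath:
  assumes "(u, v) \<in> (arcs_ends H \<inter> Z \<times> Z)\<^sup>*" "u \<in> Z" "Z \<subseteq> verts H"
  shows "\<exists>p. vpath p H \<and> hd p = u \<and> last p = v \<and> set p \<subseteq> Z"
proof -
  have "\<exists>p. vwalk p H \<and> hd p = u \<and> last p = v \<and> set p \<subseteq> Z"
    using assms(1,2)
  proof (induction rule: converse_rtrancl_induct)
    case base
    then show ?case
      using assms(3) by (intro exI[of _ "[v]"]) (auto simp: vwalk_def)
  next
    case (step u w)
    then obtain p where p: "vwalk p H" "hd p = w" "last p = v" "set p \<subseteq> Z" by auto
    then obtain q where "p = w # q" by (cases p) (auto simp: vwalk_def)
    then show ?case
      using p step assms(3) by (intro exI[of _ "u # p"]) (auto simp: vwalk_def)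
  qed
  then obtain p where p: "vwalk p H" "hd p = u" "last p = v" "set p \<subseteq> Z" by blast
  then show ?thesis
    using vwalk_to_vpath_vpath[OF p(1)] vwalk_to_vpath_hd[of p] vwalk_to_vpath_last[of p]
      vwalk_to_vpath_subset[of _ p]
    by (intro exI[of _ "vwalk_to_vpath p"]) auto
qed

text \<open>Connectivity inside \<open>Z\<close> replaces explicit paths: a path does not revisit
  its ends, so its internal vertices lie in \<open>Z - {u, v}\<close>, where \<open>c\<close> is
  injective.\<close>

lemma rainbow_vertex_connectedI:
  assumes "\<And>u v. \<lbrakk>u \<in> verts H; v \<in> verts H; u \<noteq> v\<rbrakk> \<Longrightarrow>
    \<exists>Z\<subseteq>verts H. u \<in> Z \<and> (u, v) \<in> (arcs_ends H \<inter> Z \<times> Z)\<^sup>* \<and> inj_on c (Z - {u, v})"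
  shows "rainbow_vertex_connected H c"
  unfolding rainbow_vertex_connected_def
proof (intro ballI impI)
  fix u v assume uv: "u \<in> verts H" "v \<in> verts H" "u \<noteq> v"
  from assms[OF uv] obtain Z where Z: "Z \<subseteq> verts H" "u \<in> Z"
    "(u, v) \<in> (arcs_ends H \<inter> Z \<times> Z)\<^sup>*" "inj_on c (Z - {u, v})" by blast
  from rtrancl_restrict_imp_vpath[OF Z(3,2,1)] obtain p
    where p: "vpath p H" "hd p = u" "last p = v" "set p \<subseteq> Z" by blast
  have "distinct p" "p \<noteq> []" using p(1) by (auto simp: vpath_def vwalk_def)
  then obtain q where q: "p = u # q" using p by (cases p) auto
  have "q \<noteq> []" using q p uv by auto
  then have q': "q = butlast q @ [v]" using q p by (metis append_butlast_last_id last_ConsR)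
  have d: "distinct (u # butlast q @ [v])" using \<open>distinct p\<close> q q' by simp
  have "set (butlast q) \<subseteq> set p" using q by (auto dest: in_set_butlastD)
  then have "set (butlast q) \<subseteq> Z - {u, v}"
    using d p by auto
  then have "distinct (map c (butlast q))"
    using d Z(4) by (auto simp: distinct_map intro: inj_on_subset)
  then show "\<exists>p. vpath p H \<and> hd p = u \<and> last p = v \<and> distinct (map c (butlast (tl p)))"
    using p q by (intro exI[of _ p]) auto
qed

section \<open>Random partitions into two classes\<close>

text \<open>First moment method: under a uniformly random \<open>X \<subseteq> U\<close>, the set \<open>A u\<close> is monochromatic
  with probability \<open>2 / 2 ^ card (A u) \<le> 1 / card (A u)\<close>.\<close>

lemma exists_few_monochromatic:
  fixes q :: real
  assumes "finite U" "finite Y" "q > 0"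
    and A: "\<And>u. u \<in> Y \<Longrightarrow> A u \<subseteq> U \<and> q \<le> card (A u)"
  obtains X where "X \<subseteq> U" "q * card {u \<in> Y. A u \<subseteq> X \<or> A u \<inter> X = {}} \<le> card Y"
proof -
  let ?m = "card U"
  let ?bad = "\<lambda>u X. A u \<subseteq> X \<or> A u \<inter> X = {}"
  have one: "q * card {X \<in> Pow U. ?bad u X} \<le> 2 ^ ?m" if u: "u \<in> Y" for u
  proof -
    let ?r = "card (A u)"
    have sub: "A u \<subseteq> U" and q: "q \<le> ?r" using A[OF u] by auto
    have fin: "finite (A u)" using sub assms(1) finite_subset by blast
    have cd: "card (U - A u) = ?m - ?r" "?r \<le> ?m"
      using sub fin assms(1) by (auto simp: card_Diff_subset card_mono)
    \<comment> \<open>A bad \<open>X\<close> is determined by its part outside \<open>A u\<close>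
      and the choice between containing and missing \<open>A u\<close>.\<close>
    have "{X \<in> Pow U. ?bad u X} \<subseteq> Pow (U - A u) \<union> (\<lambda>X. X \<union> A u) ` Pow (U - A u)"
    proof
      fix X assume X: "X \<in> {X \<in> Pow U. ?bad u X}"
      show "X \<in> Pow (U - A u) \<union> (\<lambda>X. X \<union> A u) ` Pow (U - A u)"
      proof (cases "A u \<inter> X = {}")
        case False
        then have "X = (X - A u) \<union> A u" "X - A u \<in> Pow (U - A u)" using X by auto
        then show ?thesis by blast
      qed (use X in auto)
    qed
    then have "card {X \<in> Pow U. ?bad u X}
        \<le> card (Pow (U - A u) \<union> (\<lambda>X. X \<union> A u) ` Pow (U - A u))"
      by (intro card_mono) (use assms(1) in auto)
    also have "\<dots> \<le> card (Pow (U - A u)) + card ((\<lambda>X. X \<union> A u) ` Pow (U - A u))"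
      by (rule card_Un_le)
    also have "\<dots> \<le> 2 ^ (?m - ?r) + 2 ^ (?m - ?r)"
      using card_image_le[of "Pow (U - A u)" "\<lambda>X. X \<union> A u"] assms(1)
      by (intro add_mono) (auto simp: card_Pow cd)
    finally have c: "card {X \<in> Pow U. ?bad u X} \<le> 2 * 2 ^ (?m - ?r)" by simp
    \<comment> \<open>\<open>q > 0\<close> rules out an empty \<open>A u\<close>, so
      \<open>?r - 1\<close> is not truncated.\<close>
    have r1: "?r \<ge> 1" using q assms(3) by (cases "?r") auto
    have r2: "?r \<le> 2 ^ (?r - 1)"
      using r1 less_exp[of "?r - 1"] by linarith
    have "q * card {X \<in> Pow U. ?bad u X} \<le> real ?r * (2 * 2 ^ (?m - ?r))"
      using c q assms(3) of_nat_mono[OF c, where 'a=real] by (intro mult_mono) auto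
    also have "\<dots> \<le> real (2 ^ (?r - 1)) * (2 * 2 ^ (?m - ?r))"
      using of_nat_mono[OF r2, where 'a=real] by (intro mult_right_mono) auto
    also have "\<dots> = 2 ^ (?r - 1 + 1 + (?m - ?r))"
      by (simp add: power_add)
    also have "?r - 1 + 1 + (?m - ?r) = ?m" using r1 cd by simp
    finally show ?thesis .
  qed
  \<comment> \<open>Averaging: if every \<open>X\<close> failed, summing over \<open>X\<close> and
    double counting the bad pairs would contradict \<open>one\<close>.\<close>
  have "\<exists>X\<in>Pow U. q * card {u \<in> Y. ?bad u X} \<le> card Y"
  proof (rule ccontr)
    assume "\<not> ?thesis"
    then have gt: "q * card {u \<in> Y. ?bad u X} > card Y" if "X \<in> Pow U" for X
      using that by (meson not_le)
    have "(\<Sum>X\<in>Pow U. real (card Y)) < (\<Sum>X\<in>Pow U. q * card {u \<in> Y. ?bad u X})"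
      using gt assms(1) by (intro sum_strict_mono) auto
    also have "\<dots> = q * real (\<Sum>X\<in>Pow U. card {u \<in> Y. ?bad u X})"
      by (simp add: sum_distrib_left)
    also have "(\<Sum>X\<in>Pow U. card {u \<in> Y. ?bad u X}) = (\<Sum>u\<in>Y. card {X \<in> Pow U. ?bad u X})"
      using assms(1,2) by (intro sum_multicount_gen[where R = "\<lambda>X u. ?bad u X"]) auto
    also have "q * real \<dots> = (\<Sum>u\<in>Y. q * card {X \<in> Pow U. ?bad u X})"
      by (simp add: sum_distrib_left)
    also have "\<dots> \<le> (\<Sum>u\<in>Y. 2 ^ ?m)"
      by (intro sum_mono one)
    finally show False using assms(1) by (simp add: card_Pow mult.commute)
  qed
  then show ?thesis using that by blast
qed

section \<open>Neighbourhoods, degrees and connectedness in a \<open>pair_graph\<close>\<close>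

lemma (in pair_graph) sym_parcs: "sym (parcs G)"
  using pair_sym_arcs by (simp add: symmetric_def)

lemma (in pair_graph) closed_nbhd_subset_verts:
  "S \<subseteq> pverts G \<Longrightarrow> closed_nbhd (parcs G) S \<subseteq> pverts G"
  by (auto simp: closed_nbhd_def dest: in_arcsD2)

lemma (in pair_graph) out_degree_eq: "out_degree (with_proj G) v = card (parcs G `` {v})"
proof -
  have "out_arcs (with_proj G) v = Pair v ` (parcs G `` {v})"
    by (auto simp: out_arcs_def)
  then show ?thesis
    by (simp add: out_degree_def card_image inj_on_def)
qed

lemma (in pair_graph) card_closed_nbhd:
  "card (closed_nbhd (parcs G) {v}) = out_degree (with_proj G) v + 1"
proof -
  have "closed_nbhd (parcs G) {v} = insert v (parcs G `` {v})"
    by (auto simp: closed_nbhd_def)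
  moreover have "v \<notin> parcs G `` {v}" using pair_no_loops[of "(v, v)"] by auto
  moreover have "finite (parcs G `` {v})"
    using finite_subset[OF _ pair_finite_verts] in_arcsD2 by (metis Image_singleton_iff subsetI)
  ultimately show ?thesis by (simp add: out_degree_eq)
qed

text \<open>Connectedness is defined through the symmetric closure, which adds no arcs to an already
  symmetric graph.\<close>

lemma (in pair_graph) connected_imp_connected_set:
  assumes "Digraph_Component.connected (with_proj G)"
  shows "connected_set (parcs G) (pverts G)" "pverts G \<noteq> {}"
proof -
  have sc: "strongly_connected (mk_symmetric (with_proj G))"
    using assms by (simp add: Digraph_Component.connected_def)
  have eq: "parcs (mk_symmetric (with_proj G)) = parcs G"
    using adj_mk_symmetric_eq pair_sym_arcs by simp
  show "pverts G \<noteq> {}" using sc by (auto simp: strongly_connected_def)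
  interpret M: wf_digraph "with_proj (mk_symmetric (with_proj G))"
    using wellformed_mk_symmetric by (simp add: wf_digraph_wp_iff)
  have "parcs G \<inter> pverts G \<times> pverts G = parcs G" by (auto dest: in_arcsD1 in_arcsD2)
  then show "connected_set (parcs G) (pverts G)"
    using sc eq unfolding strongly_connected_def connected_set_def M.reachable_conv by auto
qed

section \<open>Growing the connected set\<close>

text \<open>\<open>W\<close> collects vertices of \<open>L\<close>, each paid for separately; every other step of the construction
  adds \<open>j\<close> vertices to \<open>S\<close> and at least \<open>j * D / 6\<close> vertices to its closed neighbourhood.\<close>

lemma (in pair_graph) exists_connected_2_step_dominating_set:
  fixes D :: real
  assumes conn: "connected_set (parcs G) (pverts G)" "pverts G \<noteq> {}" and D: "D > 0"
    and high: "\<And>v. v \<in> pverts G - L \<Longrightarrow> D \<le> out_degree (with_proj G) v + 1"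
    and low: "\<And>W. W \<subseteq> L \<Longrightarrow> independent_set (with_proj G) W \<Longrightarrow> card W < k"
  obtains S where "S \<subseteq> pverts G" "S \<noteq> {}" "connected_set (parcs G) S"
    "D * card S + 2 * D \<le> D * (3 * k) + 6 * card (closed_nbhd (parcs G) S)"
    "pverts G \<subseteq> closed_nbhd (parcs G) (closed_nbhd (parcs G) S)"
    "\<And>u. u \<in> pverts G - closed_nbhd (parcs G) S \<Longrightarrow>
       2 * D / 3 \<le> card (parcs G `` {u} \<inter> closed_nbhd (parcs G) S)"
proof -
  let ?E = "parcs G" and ?V = "pverts G" and ?N = "closed_nbhd (parcs G)"
  note finN = finite_subset[OF closed_nbhd_subset_verts pair_finite_verts]
  \<comment> \<open>\<open>Q\<close> is the invariant of the growth; a \<open>Q\<close>-set of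
    greatest size is its final state. The start vertex accounts for the \<open>1\<close>, each
    vertex of \<open>W\<close> for up to three vertices of \<open>S\<close>.\<close>
  define Q where "Q S \<longleftrightarrow> S \<subseteq> ?V \<and> S \<noteq> {} \<and> connected_set ?E S \<and>
    (\<exists>W \<subseteq> S \<inter> L. independent_set (with_proj G) W \<and>
       D * card S \<le> D * (1 + 3 * card W) + 6 * card (?N S))" for S
  obtain v0 where v0: "v0 \<in> ?V" using conn by blast
  have "Q {v0}"
    unfolding Q_def using v0 D
    by (auto simp: connected_set_def independent_set_def intro!: exI[of _ "{}"])
  moreover have "\<forall>S. Q S \<longrightarrow> card S < Suc (card ?V)"
    by (auto simp: Q_def less_Suc_eq_le intro: card_mono pair_finite_verts)
  ultimately obtain S where QS: "Q S" and maxS: "\<And>T. Q T \<Longrightarrow> card T \<le> card S"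
    using ex_has_greatest_nat[of Q "{v0}" card "Suc (card ?V)"] by blast
  from QS obtain W where S: "S \<subseteq> ?V" "S \<noteq> {}" "connected_set ?E S"
    and W: "W \<subseteq> S \<inter> L" "independent_set (with_proj G) W"
    and cS: "D * card S \<le> D * (1 + 3 * card W) + 6 * card (?N S)"
    unfolding Q_def by blast
  have finS: "finite S" using S(1) pair_finite_verts finite_subset by blast
  have finW: "finite W" using W(1) finS finite_subset by blast
  \<comment> \<open>By maximality \<open>T\<close> violates \<open>Q\<close>, so its
    \<open>j\<close> new vertices can be paid for in neither way: not by putting \<open>u\<close>
    into \<open>W\<close> (independence would survive, as \<open>u\<close> is outside
    \<open>?N S\<close>), and not by the new part of \<open>?N {u}\<close>.\<close>
  have step: "u \<notin> L \<and> 6 * card (?N {u} - ?N S) < D * j"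
    if T: "S \<subset> T" "T \<subseteq> ?V" "connected_set ?E T" "card T = card S + j" "j \<le> 3"
      "u \<in> T" "u \<notin> ?N S" for T u j
  proof -
    have "finite T" using T(2) pair_finite_verts finite_subset by blast
    then have "card S < card T" using T(1) psubset_card_mono by blast
    then have nQ: "\<not> Q T" using maxS[of T] by auto
    have "card (?N S) + card (?N {u} - ?N S) = card (?N S \<union> (?N {u} - ?N S))"
      using S(1) T(2,6) by (subst card_Un_disjoint) (auto intro!: finN)
    also have "\<dots> \<le> card (?N T)"
      using T closed_nbhd_mono[of S T ?E] closed_nbhd_mono[of "{u}" T ?E]
      by (intro card_mono finN) auto
    finally have gain: "card (?N S) + card (?N {u} - ?N S) \<le> card (?N T)" .
    have "u \<notin> L"
    proof
      assume uL: "u \<in> L"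
      have "u \<notin> W" using T(7) W(1) by (auto simp: closed_nbhd_def)
      have "D * real j \<le> D * 3" using T(5) D by simp
      then have "D * card T \<le> D * (1 + 3 * card W) + 6 * card (?N S) + D * 3"
        using cS T(4) by (simp add: algebra_simps)
      also have "\<dots> \<le> D * (1 + 3 * card (insert u W)) + 6 * card (?N T)"
        using gain finW \<open>u \<notin> W\<close> by (simp add: algebra_simps)
      finally have "D * card T \<le> D * (1 + 3 * card (insert u W)) + 6 * card (?N T)" .
      moreover have "independent_set (with_proj G) (insert u W)"
        using W T(2,6,7) symD[OF sym_parcs]
        by (fastforce simp: independent_set_def closed_nbhd_def)
      ultimately have "Q T"
        unfolding Q_def using T S(2) W uL by (auto intro!: exI[of _ "insert u W"])
      then show False using nQ by blast
    qed
    moreover have "6 * card (?N {u} - ?N S) < D * j"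
    proof (rule ccontr)
      assume "\<not> ?thesis"
      then have "D * card T \<le> D * (1 + 3 * card W) + 6 * card (?N S) + 6 * card (?N {u} - ?N S)"
        using cS T(4) by (simp add: algebra_simps)
      also have "\<dots> \<le> D * (1 + 3 * card W) + 6 * card (?N T)"
        using gain by simp
      finally have "Q T"
        unfolding Q_def using T S(2) W by blast
      then show False using nQ by blast
    qed
    ultimately show ?thesis by blast
  qed
  have path2: "\<exists>y. y \<in> ?N S \<and> y \<notin> S \<and> (y, u) \<in> ?E \<and> y \<in> ?V \<and> connected_set ?E (insert y S)"
    if "u \<in> ?N (?N S) - ?N S" for u
  proof -
    from that obtain y where y: "y \<in> ?N S" "(y, u) \<in> ?E" "y \<notin> S" 
      by (auto simp: closed_nbhd_def)
    then obtain s where "s \<in> S" "(s, y) \<in> ?E" by (auto simp: closed_nbhd_def)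
    then show ?thesis
      using y connected_set_insert[OF S(3) sym_parcs] in_arcsD1 by blast
  qed
  \<comment> \<open>A walk from \<open>S\<close> to an undominated vertex has an edge
    \<open>(z, w)\<close> leaving \<open>?N (?N S)\<close>. Adding \<open>y\<close>,
    \<open>z\<close>, \<open>w\<close> would gain all of \<open>?N {w}\<close>, at least
    \<open>D\<close> vertices, while \<open>step\<close> allows fewer than
    \<open>D / 2\<close>.\<close>
  have dom: "?V \<subseteq> ?N (?N S)"
  proof (rule ccontr)
    assume "\<not> ?thesis"
    then obtain v where v: "v \<in> ?V" "v \<notin> ?N (?N S)" by blast
    obtain s where s: "s \<in> S" using S by blast
    then have "(s, v) \<in> (?E \<inter> ?V \<times> ?V)\<^sup>*" "s \<in> ?N (?N S)"
      using conn v S(1) by (auto simp: connected_set_def closed_nbhd_def)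
    then obtain z w where zw: "(z, w) \<in> ?E" "z \<in> ?N (?N S)" "w \<notin> ?N (?N S)" "w \<in> ?V" "z \<in> ?V"
      using v(2) by (auto elim: rtrancl_exits_set)
    then have z: "z \<notin> ?N S" by (auto simp: closed_nbhd_def)
    obtain y where y: "y \<in> ?N S" "y \<notin> S" "(y, z) \<in> ?E" "y \<in> ?V" "connected_set ?E (insert y S)"
      using path2 zw z by blast
    let ?T = "insert w (insert z (insert y S))"
    have ne: "z \<notin> insert y S" "w \<notin> insert z (insert y S)" "w \<notin> ?N S"
      using y z zw by (auto simp: closed_nbhd_def)
    have "connected_set ?E (insert z (insert y S))"
      using connected_set_insert[OF y(5) sym_parcs _ y(3)] by blast
    then have cT: "connected_set ?E ?T"
      using connected_set_insert[OF _ sym_parcs _ zw(1)] by blast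
    have "w \<notin> L \<and> 6 * card (?N {w} - ?N S) < D * real 3"
      by (rule step[of ?T]) (use cT ne y zw S finS in auto)
    moreover have "?N {w} - ?N S = ?N {w}"
      using zw(3) symD[OF sym_parcs] by (fastforce simp: closed_nbhd_def)
    ultimately show False
      using high[of w] zw(4) D by (simp add: card_closed_nbhd)
  qed
  show ?thesis
  proof (rule that[OF S])
    \<comment> \<open>The slack \<open>2 * D\<close> comes from
      \<open>1 + 3 * card W \<le> 3 * k - 2\<close>; it will pay for the two extra colours.\<close>
    have "card W + 1 \<le> k" using low[of W] W by auto
    then have "real (card W) + 1 \<le> real k" by linarith
    then have "D * (real (card W) + 1) \<le> D * real k" using D by simp
    then show "D * card S + 2 * D \<le> D * (3 * k) + 6 * card (?N S)"
      using cS by (simp add: algebra_simps)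
    fix u assume u: "u \<in> ?V - ?N S"
    then obtain y where y: "y \<in> ?N S" "y \<notin> S" "(y, u) \<in> ?E" "y \<in> ?V"
      "connected_set ?E (insert y S)"
      using path2 dom by blast
    have ne: "u \<notin> insert y S" using u y by (auto simp: closed_nbhd_def)
    have "connected_set ?E (insert u (insert y S))"
      using connected_set_insert[OF y(5) sym_parcs _ y(3)] by blast
    \<comment> \<open>With \<open>j = 2\<close>, fewer than \<open>D / 3\<close> vertices of
      \<open>?N {u}\<close> lie outside \<open>?N S\<close>; the others are neighbours of
      \<open>u\<close>, since \<open>u\<close> itself is outside \<open>?N S\<close>.\<close>
    then have st: "u \<notin> L \<and> 6 * card (?N {u} - ?N S) < D * real 2"
      by (intro step[of "insert u (insert y S)"]) (use ne y u S finS in auto)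
    have "?N {u} \<inter> ?N S = ?E `` {u} \<inter> ?N S" using u by (auto simp: closed_nbhd_def)
    then have "card (?N {u}) = card (?E `` {u} \<inter> ?N S) + card (?N {u} - ?N S)"
      using card_Int_Diff[of "?N {u}" "?N S"] finN[of "{u}"] u by simp
    then show "2 * D / 3 \<le> card (?E `` {u} \<inter> ?N S)"
      using st high[of u] u by (simp add: card_closed_nbhd)
  qed (rule dom)
qed

section \<open>Colouring along a connected set\<close>

text \<open>Two colour classes outside \<open>S\<close> suffice: a vertex that sees both of them can leave towards
  \<open>S\<close> through either one, so two vertices can always choose different classes.\<close>

lemma (in pair_graph) rvc_le_card_connected_set:
  assumes S: "S \<subseteq> pverts G" "connected_set (parcs G) S"
    and sees: "\<And>u b. u \<in> pverts G - closed_nbhd (parcs G) S \<Longrightarrow>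
      \<exists>x\<in>closed_nbhd (parcs G) S. (u, x) \<in> parcs G \<and> (x \<in> X \<longleftrightarrow> b)"
  shows "rvc (with_proj G) \<le> card S + 2"
proof -
  let ?E = "parcs G" and ?V = "pverts G" and ?N = "closed_nbhd (parcs G)"
  have finS: "finite S" using S(1) pair_finite_verts finite_subset by blast
  obtain f :: "'a \<Rightarrow> nat" where f: "bij_betw f S {0..<card S}"
    using finS ex_bij_betw_finite_nat by blast
  \<comment> \<open>The shift by 2 reserves colours 0 and 1 for the two classes.\<close>
  define c where "c v = (if v \<in> S then f v + 2 else if v \<in> X then 1 else 0)" for v
  \<comment> \<open>The reflexive closures allow \<open>x = u\<close> or \<open>x = s\<close>, which
    covers \<open>u\<close> in \<open>?N S\<close>; only a genuine intermediate vertex outside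
    \<open>S\<close> must have the prescribed class.\<close>
  have attach: "\<exists>x s. s \<in> S \<and> x \<in> ?V \<and> x \<in> S \<union> {u} \<union> {y. y \<notin> S \<and> (y \<in> X \<longleftrightarrow> b)} \<and>
      (u, x) \<in> ?E\<^sup>= \<and> (x, s) \<in> ?E\<^sup>=" if u: "u \<in> ?V" for u b
  proof (cases "u \<in> ?N S")
    case True
    then show ?thesis
      using u sym_parcs[THEN symD] by (auto simp: closed_nbhd_def)
  next
    case False
    with sees[of u b] u obtain x
      where x: "x \<in> ?N S" "(u, x) \<in> ?E" "x \<in> X \<longleftrightarrow> b" by blast
    then have "x \<notin> S" using False sym_parcs[THEN symD] by (auto simp: closed_nbhd_def)
    then obtain s where "s \<in> S" "(x, s) \<in> ?E"
      using x sym_parcs[THEN symD] by (auto simp: closed_nbhd_def)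
    then show ?thesis using x \<open>x \<notin> S\<close> in_arcsD2 by blast
  qed
  have "rainbow_vertex_connected (with_proj G) c"
  proof (rule rainbow_vertex_connectedI, unfold with_proj_simps)
    fix u v assume uv: "u \<in> ?V" "v \<in> ?V"
    obtain x s where x: "s \<in> S" "x \<in> ?V" "x \<in> S \<union> {u} \<union> {y. y \<notin> S \<and> (y \<in> X \<longleftrightarrow> True)}"
      "(u, x) \<in> ?E\<^sup>=" "(x, s) \<in> ?E\<^sup>=" using attach[OF uv(1)] by blast
    obtain y t where y: "t \<in> S" "y \<in> ?V" "y \<in> S \<union> {v} \<union> {y. y \<notin> S \<and> (y \<in> X \<longleftrightarrow> False)}"
      "(v, y) \<in> ?E\<^sup>=" "(y, t) \<in> ?E\<^sup>=" using attach[OF uv(2)] by blast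
    let ?Z = "S \<union> {u, x, y, v}"
    let ?R = "?E \<inter> ?Z \<times> ?Z"
    have "(u, x) \<in> ?R\<^sup>*" "(x, s) \<in> ?R\<^sup>*" using x by auto
    moreover have "(s, t) \<in> ?R\<^sup>*"
    proof -
      have "(?E \<inter> S \<times> S)\<^sup>* \<subseteq> ?R\<^sup>*" by (rule rtrancl_mono) blast
      then show ?thesis using S(2) x(1) y(1) unfolding connected_set_def by blast
    qed
    moreover have "(t, y) \<in> ?R\<^sup>*" "(y, v) \<in> ?R\<^sup>*" using y sym_parcs[THEN symD] by auto
    ultimately have "(u, v) \<in> ?R\<^sup>*" by (meson rtrancl_trans)
    moreover have "inj_on f S" using f by (auto simp: bij_betw_def)
    \<comment> \<open>Outside \<open>S\<close>, only \<open>x\<close> with colour 1 and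
      \<open>y\<close> with colour 0 can remain once \<open>u\<close> and \<open>v\<close> are
      removed.\<close>
    then have "inj_on c (?Z - {u, v})"
      using x(3) y(3) unfolding inj_on_def c_def by auto
    ultimately show "\<exists>Z\<subseteq>?V. u \<in> Z \<and> (u, v) \<in> (?E \<inter> Z \<times> Z)\<^sup>* \<and> inj_on c (Z - {u, v})"
      using uv x y S(1) by (intro exI[of _ ?Z]) auto
  qed
  then have "rvc (with_proj G) \<le> card (c ` pverts G)"
    unfolding rvc_def by (intro Least_le exI[of _ c]) auto
  also have "c ` pverts G \<subseteq> {..<card S + 2}"
    using f by (auto simp: c_def bij_betw_def)
  then have "card (c ` pverts G) \<le> card {..<card S + 2}"
    by (intro card_mono) auto
  finally show ?thesis by simp
qed

section \<open>Adding up the costs, and the bound in terms of \<open>sigma\<close>\<close>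

lemma (in pair_graph) rvc_bound_of_independent_low_degree:
  fixes D :: real
  assumes conn: "connected_set (parcs G) (pverts G)" "pverts G \<noteq> {}" and D: "D > 0"
    and high: "\<And>v. v \<in> pverts G - L \<Longrightarrow> D \<le> out_degree (with_proj G) v + 1"
    and low: "\<And>W. W \<subseteq> L \<Longrightarrow> independent_set (with_proj G) W \<Longrightarrow> card W < k"
  shows "real (rvc (with_proj G)) \<le> 6 * real (card (pverts G)) / D + 3 * real k"
proof -
  let ?E = "parcs G" and ?V = "pverts G" and ?N = "closed_nbhd (parcs G)"
  obtain S where S: "S \<subseteq> ?V" "S \<noteq> {}" "connected_set ?E S"
    and cS: "D * card S + 2 * D \<le> D * (3 * k) + 6 * card (?N S)"
    and dom: "?V \<subseteq> ?N (?N S)"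
    and many: "\<And>u. u \<in> ?V - ?N S \<Longrightarrow> 2 * D / 3 \<le> card (?E `` {u} \<inter> ?N S)"
    using exists_connected_2_step_dominating_set[OF conn D high low] by metis
  have NV: "?N S \<subseteq> ?V" using S(1) by (rule closed_nbhd_subset_verts)
  let ?A = "\<lambda>u. ?E `` {u} \<inter> ?N S"
  obtain X where X: "X \<subseteq> ?N S"
    and bad: "2 * D / 3 * card {u \<in> ?V - ?N S. ?A u \<subseteq> X \<or> ?A u \<inter> X = {}} \<le> card (?V - ?N S)"
  proof (rule exists_few_monochromatic[of "?N S" "?V - ?N S" "2 * D / 3" ?A])
    show "finite (?N S)" using NV pair_finite_verts finite_subset by blast
  qed (use many D pair_finite_verts in auto)
  define B where "B = {u \<in> ?V - ?N S. ?A u \<subseteq> X \<or> ?A u \<inter> X = {}}"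
  have finB: "finite B" using pair_finite_verts by (auto simp: B_def)
  \<comment> \<open>As \<open>u\<close> is outside \<open>?N S\<close>, its neighbour in
    \<open>?N S\<close> is not in \<open>S\<close> but adjacent to it. Adding that neighbour keeps
    \<open>S\<close> connected and brings \<open>u\<close> into the closed neighbourhood.\<close>
  have "\<forall>u\<in>B. \<exists>y. y \<in> ?E `` S \<and> (y, u) \<in> ?E"
    using dom unfolding B_def closed_nbhd_def by blast
  then obtain y where y: "\<And>u. u \<in> B \<Longrightarrow> y u \<in> ?E `` S \<and> (y u, u) \<in> ?E" by metis
  define S' where "S' = S \<union> y ` B"
  have sub: "?N S \<subseteq> ?N S'" by (rule closed_nbhd_mono) (simp add: S'_def)
  have BN: "B \<subseteq> ?N S'" using y by (force simp: S'_def closed_nbhd_def)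
  have "rvc (with_proj G) \<le> card S' + 2"
  proof (rule rvc_le_card_connected_set)
    show "S' \<subseteq> ?V" using S(1) y in_arcsD1 by (auto simp: S'_def)
    show "connected_set ?E S'"
      unfolding S'_def using finB y by (intro connected_set_Un S sym_parcs) auto
    fix u b assume "u \<in> ?V - ?N S'"
    then have "\<not> ?A u \<subseteq> X" "?A u \<inter> X \<noteq> {}" using BN sub by (auto simp: B_def)
    then show "\<exists>x\<in>?N S'. (u, x) \<in> ?E \<and> (x \<in> X \<longleftrightarrow> b)"
      using sub by (cases b) blast+
  qed
  also have "card S' \<le> card S + card B"
    unfolding S'_def using card_Un_le[of S "y ` B"] card_image_le[OF finB, of y] by linarith
  finally have "real (rvc (with_proj G)) \<le> card S + card B + 2" by linarith
  then have "D * rvc (with_proj G) \<le> D * (card S + card B + 2)"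
    using D by simp
  also have "\<dots> = D * card S + 2 * D + D * card B" by (simp add: algebra_simps)
  also have "\<dots> \<le> D * (3 * k) + 6 * card (?N S) + 6 * card (?V - ?N S)"
  proof -
    \<comment> \<open>The factor 3/2 from \<open>bad\<close> is weakened to 6, so that vertices
      inside and outside \<open>?N S\<close> are charged at the same rate and sum to
      \<open>6 * card ?V\<close>.\<close>
    have "D * card B \<le> 6 * card (?V - ?N S)"
      using bad unfolding B_def[symmetric] by (simp add: field_simps)
    then show ?thesis using cS by linarith
  qed
  also have "\<dots> = D * (3 * k) + 6 * card ?V"
  proof -
    have "card ?V = card (?N S) + card (?V - ?N S)"
      using card_Int_Diff[OF pair_finite_verts, of "?N S"] NV by (simp add: Int_absorb1)
    then show ?thesis by simp
  qed
  finally show ?thesis using D by (simp add: field_simps)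
qed

lemma (in pair_graph) rvc_le_sigma:
  assumes "k \<ge> 1" "Digraph_Component.connected (with_proj G)"
  shows "real (rvc (with_proj G))
    \<le> 6 * real k * real (card (pverts G)) / (real (sigma k (with_proj G)) + real k) + 3 * real k"
proof -
  let ?s = "sigma k (with_proj G)" and ?d = "out_degree (with_proj G)"
  \<comment> \<open>This is \<open>?d v + 1 < D\<close> with the denominator cleared.\<close>
  define L where "L = {v \<in> pverts G. k * ?d v < ?s}"
  define D where "D = (real ?s + k) / k"
  have D: "D > 0" using assms(1) by (simp add: D_def)
  have "real (rvc (with_proj G)) \<le> 6 * real (card (pverts G)) / D + 3 * real k"
  proof (rule rvc_bound_of_independent_low_degree[OF connected_imp_connected_set[OF assms(2)] D])
    fix v assume "v \<in> pverts G - L"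
    then have "?s \<le> k * ?d v" by (auto simp: L_def)
    then have "real ?s \<le> k * ?d v" by (metis of_nat_le_iff of_nat_mult)
    then show "D \<le> ?d v + 1" using assms(1) by (simp add: D_def field_simps)
  next
    fix W assume W: "W \<subseteq> L" "independent_set (with_proj G) W"
    show "card W < k"
    proof (rule ccontr)
      assume "\<not> ?thesis"
      \<comment> \<open>\<open>sigma\<close> ranges over sets of exactly \<open>k\<close> vertices,
        so \<open>W\<close> is first cut down to that size.\<close>
      then obtain U where U: "U \<subseteq> W" "card U = k" "finite U"
        using obtain_subset_with_card_n[of k W] by (auto simp: not_less)
      let ?M = "{(\<Sum>u\<in>S. ?d u) | S. independent_set (with_proj G) S \<and> card S = k}"
      have "?M \<subseteq> (\<lambda>S. \<Sum>u\<in>S. ?d u) ` Pow (pverts G)"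
        by (auto simp: independent_set_def)
      then have "finite ?M"
        by (rule finite_subset) (simp add: pair_finite_verts)
      moreover have "independent_set (with_proj G) U"
        using W(2) U(1) by (auto simp: independent_set_def)
      ultimately have "?s \<le> (\<Sum>u\<in>U. ?d u)"
        unfolding sigma_def using U(2) by (intro Min_le) auto
      then have "k * ?s \<le> (\<Sum>u\<in>U. k * ?d u)"
        by (simp flip: sum_distrib_left)
      \<comment> \<open>Strict because \<open>U\<close> is nonempty, by
        \<open>k \<ge> 1\<close>.\<close>
      also have "\<dots> < (\<Sum>u\<in>U. ?s)"
        using U W(1) assms(1) by (intro sum_strict_mono) (auto simp: L_def)
      finally show False using U(2) by simp
    qed
  qed
  then show ?thesis using assms(1) by (simp add: D_def mult.commute mult.left_commute)
qed

theorem theorem9: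
  fixes G :: "'a pair_pre_digraph" and k n :: nat
  assumes "k \<ge> 1"
    and "pair_graph G"
    and "Digraph_Component.connected (with_proj G)"
    and "card (verts (with_proj G)) = n"
    and "\<exists>S. independent_set (with_proj G) S \<and> card S = k"
  shows "(sigma k (with_proj G) \<le> 7 * k \<or> sigma k (with_proj G) \<ge> 8 * k \<longrightarrow>
            real (rvc (with_proj G)) \<le>
              (4 * real k + 2 * (real k)\<^sup>2) * real n / (real (sigma k (with_proj G)) + real k)
                + 5 * real k)
       \<and> (7 * k < sigma k (with_proj G) \<and> sigma k (with_proj G) < 8 * k \<longrightarrow>
            real (rvc (with_proj G)) \<le>
              (38 * real k / 9 + 2 * (real k)\<^sup>2) * real n / (real (sigma k (with_proj G)) + real k)
                + 5 * real k)"
proof -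
  interpret pair_graph G by fact
  let ?s = "sigma k (with_proj G)"
  have bound: "real (rvc (with_proj G)) \<le> a * real n / (real ?s + real k) + 5 * real k"
    if a: "6 * real k \<le> a" for a
  proof -
    have "6 * real k * n / (real ?s + k) \<le> a * n / (real ?s + k)"
      using a by (intro divide_right_mono mult_right_mono) auto
    then show ?thesis
      using rvc_le_sigma[OF assms(1,3)] assms(4) by simp
  qed
  \<comment> \<open>Both claimed coefficients of \<open>n\<close> dominate \<open>6 * k\<close>: the
    square contributes at least \<open>2 * k\<close>, and 38/9 exceeds 4.\<close>
  have "real k \<le> (real k)\<^sup>2" using assms(1) by (simp add: power2_eq_square)
  then have "6 * real k \<le> 4 * real k + 2 * (real k)\<^sup>2"
    "6 * real k \<le> 38 * real k / 9 + 2 * (real k)\<^sup>2" by linarith+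
  then show ?thesis using bound by blast
qed

end
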